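(* Let $n\ge 0$ and let $\psi_n=B_0\lambda^n+B_1\lambda^{n-1}+\cdots+B_n$ be an NLS $n$-soliton. (1) $\psi_n$ can be written as a linear combination, with coefficients constant in $x$, of the basic polynomials $\phi_n,\phi_{n-1},\ldots,\phi_0$. (2) Moreover, if $\psi_n=\alpha_0\phi_n+\alpha_1\phi_{n-1}+\cdots+\alpha_n\phi_0$ with constants $\alpha_j$, then $$B_i=\sum_{j=0}^{i}\alpha_jA_{i-j}\qquad (0\le i\le n).$$ Hence the conditions $$\text{(A)}\quad B_{n-1}''=2\int\left[\langle E,B_n\rangle+\langle F,B_{n-1}\rangle\right]dx,\qquad \text{(B)}\quad B_n''=2\int\langle F,B_n\rangle\,dx$$ (with $B_{-1}=0$) can be written respectively as $$\sum_{k=0}^{n}\alpha_k\mathcal{A}_{n-k}=0\qquad\text{and}\qquad\sum_{k=0}^{n}\alpha_k\mathcal{B}_{n-k}=0,$$ where, for $i=0,1,\ldots,n$, $$\mathcal{A}_i=A_{i-1}''-2\int\left[\langle E,A_i\rangle+\langle F,A_{i-1}\rangle\right]dx,\qquad \mathcal{B}_i=A_i''-2\int\langle F,A_i\rangle\,dx.$$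
   Context: Let $q$ be a smooth, nowhere vanishing complex-valued function of $x$ on an open interval (at fixed time), $\sigma=\pm1$, $'$ or subscript $x$ denotes $d/dx$, and $\lambda$ is a parameter independent of $x$. Put $E=\dfrac{iq_x}{q}$ and $F=-\tfrac14E^2-\sigma|q|^2+\tfrac{i}{2}E'$. For functions $\psi,\phi$ of $x$ let $\langle\psi,\phi\rangle=\psi_x\phi+2\psi\phi_x$. Define $A_{-1}=0$, $A_0=2$ and, for $j\ge1$, $$A_j=\frac12\int\left[\langle E,A_{j-1}\rangle+\langle F,A_{j-2}\rangle\right]dx-\frac14A_{j-2}'',$$ with all constants of integration taken to be zero (so each $A_j$, $j\ge1$, is a differential polynomial in $E,F$ with zero constant term; e.g. $A_1=E$, $A_2=\tfrac34E^2+F$). The basic polynomials are $\phi_n=A_0\lambda^n+A_1\lambda^{n-1}+\cdots+A_n$, $n\ge0$. An NLS $n$-soliton is a polynomial $\psi_n=B_0\lambda^n+B_1\lambda^{n-1}+\cdots+B_n$ with $B_0$ constant and $B_i$ smooth functions of $x$ (independent of $\lambda$), which satisfies, identically as a polynomial in $\lambda$, $$\psi'''+4\lambda^2\psi'-2\left[\lambda\langle E,\psi\rangle+\langle F,\psi\rangle\right]=0 .$$ In conditions (A), (B) and in the definitions of $\mathcal{A}_i,\mathcal{B}_i$, indefinite integrals are determined only up to an additive constant, and the equalities are understood up to such constants (i.e. they are equivalent to the equalities obtained by differentiating once in $x$). *)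

theory Defs
  imports "HOL-Analysis.Analysis" "HOL-Library.Poly_Mapping"
begin

section \<open>Functions of one real variable\<close>

definition dx :: "(real \<Rightarrow> complex) \<Rightarrow> real \<Rightarrow> complex" where
  "dx f x = vector_derivative f (at x)"

definition smooth_on :: "real set \<Rightarrow> (real \<Rightarrow> complex) \<Rightarrow> bool" where
  "smooth_on I f \<longleftrightarrow> (\<forall>k. \<forall>x\<in>I. (dx ^^ k) f differentiable (at x))"

text \<open>
  A chosen antiderivative on \<open>I\<close>.  The choice matters only up to an additive constant, and
  everything stated with \<open>indef\<close> is stated up to additive constants, by \<open>eq_upto_const\<close>.
\<close>

definition indef :: "real set \<Rightarrow> (real \<Rightarrow> complex) \<Rightarrow> real \<Rightarrow> complex" where
  "indef I f = (SOME G. \<forall>x\<in>I. (G has_vector_derivative f x) (at x))"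

definition eq_upto_const ::
  "real set \<Rightarrow> (real \<Rightarrow> complex) \<Rightarrow> (real \<Rightarrow> complex) \<Rightarrow> bool" where
  "eq_upto_const I f g \<longleftrightarrow> (\<exists>c. \<forall>x\<in>I. f x = g x + c)"

definition bracket ::
  "(real \<Rightarrow> complex) \<Rightarrow> (real \<Rightarrow> complex) \<Rightarrow> real \<Rightarrow> complex" where
  "bracket f g x = dx f x * g x + 2 * f x * dx g x"

text \<open>\<open>prev C i\<close> is $C_{i-1}$, with the convention $C_{-1} = 0$.\<close>

definition prev :: "(nat \<Rightarrow> real \<Rightarrow> complex) \<Rightarrow> nat \<Rightarrow> real \<Rightarrow> complex" where
  "prev C i = (case i of 0 \<Rightarrow> (\<lambda>_. 0) | Suc k \<Rightarrow> C k)"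


section \<open>Differential polynomials in two indeterminates\<close>

text \<open>
  \<open>JE k\<close> and \<open>JF k\<close> stand for the \<open>k\<close>-th derivatives of \<open>E\<close> and \<open>F\<close>, treated as independent
  indeterminates, so that ``constant term'' is meaningful.  A \<open>dpoly\<close> maps monomials
  (finitely supported exponent functions) to coefficients.
\<close>

datatype jet = JE nat | JF nat

type_synonym dpoly = "(jet \<Rightarrow>\<^sub>0 nat) \<Rightarrow>\<^sub>0 complex"

fun next_jet :: "jet \<Rightarrow> jet" where
  "next_jet (JE k) = JE (Suc k)"
| "next_jet (JF k) = JF (Suc k)"

definition dp_const :: "complex \<Rightarrow> dpoly" where
  "dp_const c = Poly_Mapping.single 0 c"

definition dp_var :: "jet \<Rightarrow> dpoly" where
  "dp_var v = Poly_Mapping.single (Poly_Mapping.single v 1) 1"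

text \<open>The derivation of the polynomial ring that sends \<open>dp_var v\<close> to \<open>dp_var (next_jet v)\<close>.\<close>

definition dp_D :: "dpoly \<Rightarrow> dpoly" where
  "dp_D P = (\<Sum>m\<in>Poly_Mapping.keys P. \<Sum>v\<in>Poly_Mapping.keys m.
     Poly_Mapping.single
       (m - Poly_Mapping.single v 1 + Poly_Mapping.single (next_jet v) 1)
       (Poly_Mapping.lookup P m * of_nat (Poly_Mapping.lookup m v)))"

text \<open>
  Integration with zero constant of integration.  Only constants have zero derivative, so
  there is at most one such \<open>Q\<close>.
\<close>

definition dp_int :: "dpoly \<Rightarrow> dpoly" where
  "dp_int P = (SOME Q. dp_D Q = P \<and> Poly_Mapping.lookup Q 0 = 0)"

definition dp_bracket :: "dpoly \<Rightarrow> dpoly \<Rightarrow> dpoly" where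
  "dp_bracket P Q = dp_D P * Q + 2 * P * dp_D Q"

text \<open>In the equation for \<open>Suc 0\<close> the terms with $A_{-1} = 0$ are dropped.\<close>

fun dpA :: "nat \<Rightarrow> dpoly" where
  "dpA 0 = 2"
| "dpA (Suc 0) = dp_const (1/2) * dp_int (dp_bracket (dp_var (JE 0)) (dpA 0))"
| "dpA (Suc (Suc j)) =
     dp_const (1/2) * dp_int (dp_bracket (dp_var (JE 0)) (dpA (Suc j))
                              + dp_bracket (dp_var (JF 0)) (dpA j))
     - dp_const (1/4) * dp_D (dp_D (dpA j))"

fun jet_value :: "(real \<Rightarrow> complex) \<Rightarrow> (real \<Rightarrow> complex) \<Rightarrow> real \<Rightarrow> jet \<Rightarrow> complex" where
  "jet_value e f x (JE k) = (dx ^^ k) e x"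
| "jet_value e f x (JF k) = (dx ^^ k) f x"

definition dp_eval :: "(real \<Rightarrow> complex) \<Rightarrow> (real \<Rightarrow> complex) \<Rightarrow> dpoly \<Rightarrow> real \<Rightarrow> complex" where
  "dp_eval e f P x = (\<Sum>m\<in>Poly_Mapping.keys P. Poly_Mapping.lookup P m *
     (\<Prod>v\<in>Poly_Mapping.keys m. jet_value e f x v ^ Poly_Mapping.lookup m v))"


section \<open>NLS solitons\<close>

definition Efun :: "(real \<Rightarrow> complex) \<Rightarrow> real \<Rightarrow> complex" where
  "Efun q x = \<i> * dx q x / q x"

definition Ffun :: "real \<Rightarrow> (real \<Rightarrow> complex) \<Rightarrow> real \<Rightarrow> complex" where
  "Ffun \<sigma> q x = - (1/4) * (Efun q x)\<^sup>2 - of_real (\<sigma> * (cmod (q x))\<^sup>2) + \<i> / 2 * dx (Efun q) x"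

definition Afun :: "real \<Rightarrow> (real \<Rightarrow> complex) \<Rightarrow> nat \<Rightarrow> real \<Rightarrow> complex" where
  "Afun \<sigma> q j = dp_eval (Efun q) (Ffun \<sigma> q) (dpA j)"

definition lam_poly :: "nat \<Rightarrow> (nat \<Rightarrow> real \<Rightarrow> complex) \<Rightarrow> complex \<Rightarrow> real \<Rightarrow> complex" where
  "lam_poly n C lam x = (\<Sum>i\<le>n. C i x * lam ^ (n - i))"

definition basic_poly :: "real \<Rightarrow> (real \<Rightarrow> complex) \<Rightarrow> nat \<Rightarrow> complex \<Rightarrow> real \<Rightarrow> complex" where
  "basic_poly \<sigma> q n = lam_poly n (Afun \<sigma> q)"

definition nls_soliton ::
  "real set \<Rightarrow> real \<Rightarrow> (real \<Rightarrow> complex) \<Rightarrow> nat \<Rightarrow> (nat \<Rightarrow> real \<Rightarrow> complex) \<Rightarrow> bool" where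
  "nls_soliton I \<sigma> q n B \<longleftrightarrow>
     (\<exists>c. \<forall>x\<in>I. B 0 x = c) \<and>
     (\<forall>i\<le>n. smooth_on I (B i)) \<and>
     (\<forall>lam. \<forall>x\<in>I. let \<psi> = lam_poly n B lam in
        dx (dx (dx \<psi>)) x + 4 * lam\<^sup>2 * dx \<psi> x
        - 2 * (lam * bracket (Efun q) \<psi> x + bracket (Ffun \<sigma> q) \<psi> x) = 0)"

definition cond_A ::
  "real set \<Rightarrow> real \<Rightarrow> (real \<Rightarrow> complex) \<Rightarrow> nat \<Rightarrow> (nat \<Rightarrow> real \<Rightarrow> complex) \<Rightarrow> bool" where
  "cond_A I \<sigma> q n B \<longleftrightarrow>
     eq_upto_const I (dx (dx (prev B n)))
       (\<lambda>x. 2 * indef I (\<lambda>y. bracket (Efun q) (B n) y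
                              + bracket (Ffun \<sigma> q) (prev B n) y) x)"

definition cond_B ::
  "real set \<Rightarrow> real \<Rightarrow> (real \<Rightarrow> complex) \<Rightarrow> nat \<Rightarrow> (nat \<Rightarrow> real \<Rightarrow> complex) \<Rightarrow> bool" where
  "cond_B I \<sigma> q n B \<longleftrightarrow>
     eq_upto_const I (dx (dx (B n))) (\<lambda>x. 2 * indef I (bracket (Ffun \<sigma> q) (B n)) x)"

text \<open>
  The difference of the two sides of (A), respectively (B), for a coefficient sequence \<open>C\<close>.
  For \<open>C = Afun \<sigma> q\<close> these are $\mathcal{A}_i$ and $\mathcal{B}_i$.
\<close>

definition diff_A ::
  "real set \<Rightarrow> real \<Rightarrow> (real \<Rightarrow> complex) \<Rightarrow> (nat \<Rightarrow> real \<Rightarrow> complex) \<Rightarrow> nat \<Rightarrow> real \<Rightarrow> complex" where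
  "diff_A I \<sigma> q C i x = dx (dx (prev C i)) x
     - 2 * indef I (\<lambda>y. bracket (Efun q) (C i) y + bracket (Ffun \<sigma> q) (prev C i) y) x"

definition diff_B ::
  "real set \<Rightarrow> real \<Rightarrow> (real \<Rightarrow> complex) \<Rightarrow> (nat \<Rightarrow> real \<Rightarrow> complex) \<Rightarrow> nat \<Rightarrow> real \<Rightarrow> complex" where
  "diff_B I \<sigma> q C i x = dx (dx (C i)) x - 2 * indef I (bracket (Ffun \<sigma> q) (C i)) x"

abbreviation calA :: "real set \<Rightarrow> real \<Rightarrow> (real \<Rightarrow> complex) \<Rightarrow> nat \<Rightarrow> real \<Rightarrow> complex" where
  "calA I \<sigma> q \<equiv> diff_A I \<sigma> q (Afun \<sigma> q)"

abbreviation calB :: "real set \<Rightarrow> real \<Rightarrow> (real \<Rightarrow> complex) \<Rightarrow> nat \<Rightarrow> real \<Rightarrow> complex" where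
  "calB I \<sigma> q \<equiv> diff_B I \<sigma> q (Afun \<sigma> q)"

text \<open>$\psi_n = \alpha_0\phi_n + \alpha_1\phi_{n-1} + \cdots + \alpha_n\phi_0$ on \<open>I\<close>, identically in $\lambda$.\<close>

definition basic_expansion ::
  "real set \<Rightarrow> real \<Rightarrow> (real \<Rightarrow> complex) \<Rightarrow> nat \<Rightarrow> (nat \<Rightarrow> real \<Rightarrow> complex) \<Rightarrow> (nat \<Rightarrow> complex) \<Rightarrow> bool"
where
  "basic_expansion I \<sigma> q n B \<alpha> \<longleftrightarrow>
     (\<forall>lam. \<forall>x\<in>I. lam_poly n B lam x = (\<Sum>j\<le>n. \<alpha> j * basic_poly \<sigma> q (n - j) lam x))"

end

theory Submission
  imports Defs
begin

text \<open>
  The coefficients of \<open>\<lambda>\<close> in the soliton equation say that \<open>B\<close> obeys, up to index \<open>n\<close>, the same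
  differentiated recursion as \<open>A\<close>; the recursion is linear, so each integration constant of \<open>B\<close>
  contributes one constant \<open>\<alpha>\<^sub>j\<close>.

  The point that needs work is that the recursion for \<open>A\<close> never leaves the differential polynomials,
  that is, that the integrand is a total derivative.  The series
  \<open>\<Phi> = A\<^sub>0 + A\<^sub>1 X + A\<^sub>2 X\<^sup>2 + \<dots>\<close> with \<open>X = 1 / \<lambda>\<close> should satisfy
  \<open>X\<^sup>2 \<Phi>''' + 4 \<Phi>' - 2 X \<langle>E, \<Phi>\<rangle> - 2 X\<^sup>2 \<langle>F, \<Phi>\<rangle> = 0\<close>.
  Multiplied by \<open>2 \<Phi>\<close>, the left-hand side is the derivative of
  \<open>X\<^sup>2 (2 \<Phi> \<Phi>'' - \<Phi>'\<^sup>2) + 4 (1 - X E - X\<^sup>2 F) \<Phi>\<^sup>2\<close>.  Hence, if the equation holds below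
  order \<open>j\<close>, its \<open>j\<close>-th coefficient is exact, and so is the integrand that defines \<open>A\<^sub>j\<close>.
\<close>

section \<open>The ring of differential polynomials\<close>

lemma dpoly_induct [case_names single add]:
  fixes p :: dpoly
  assumes "\<And>m c. P (Poly_Mapping.single m c)"
    and "\<And>p q. P p \<Longrightarrow> P q \<Longrightarrow> P (p + q)"
  shows "P p"
proof (induction p rule: Poly_Mapping.update_induct)
  case const
  show ?case using assms(1)[of 0 0] by simp
next
  case (update f a b)
  have "Poly_Mapping.update a b f = Poly_Mapping.single a b + f"
    using update.hyps(1)
    by (intro poly_mapping_eqI)
       (auto simp: lookup_update lookup_add lookup_single when_def in_keys_iff)
  then show ?case
    using assms update.IH by auto
qed

lemma single_Suc_lookup:
  "Poly_Mapping.single v (Suc k) = Poly_Mapping.single v 1 + (Poly_Mapping.single v k :: 'a \<Rightarrow>\<^sub>0 nat)"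
  by (metis plus_1_eq_Suc single_add)

text \<open>Constants and variables generate the ring. This serves to compare \<open>dp_D\<close>
  with differentiation of functions: checking whole monomials would need the derivative of a finite
  product of powers.\<close>

lemma dpoly_ring_induct [case_names const var add mult]:
  fixes p :: dpoly
  assumes const: "\<And>c. P (dp_const c)" and var: "\<And>v. P (dp_var v)"
    and add: "\<And>p q. P p \<Longrightarrow> P q \<Longrightarrow> P (p + q)"
    and mult: "\<And>p q. P p \<Longrightarrow> P q \<Longrightarrow> P (p * q)"
  shows "P p"
proof (induction p rule: dpoly_induct)
  case (single m c)
  have pow: "P (Poly_Mapping.single (Poly_Mapping.single v k) 1)" for v k
  proof (induction k)
    case 0
    then show ?case using const[of 1] by (simp add: dp_const_def)
  next
    case (Suc k)
    have "dp_var v * Poly_Mapping.single (Poly_Mapping.single v k) 1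
        = Poly_Mapping.single (Poly_Mapping.single v (Suc k)) 1"
      by (simp add: dp_var_def mult_single single_Suc_lookup[of v k])
    then show ?case using mult[OF var[of v] Suc] by simp
  qed
  have mon: "P (Poly_Mapping.single m 1)"
  proof (induction m rule: Poly_Mapping.update_induct)
    case const
    show ?case using assms(1)[of 1] by (simp add: dp_const_def)
  next
    case (update f a b)
    have "Poly_Mapping.update a b f = Poly_Mapping.single a b + f"
      using update.hyps(1)
      by (intro poly_mapping_eqI)
         (auto simp: lookup_update lookup_add lookup_single when_def in_keys_iff)
    then show ?case
      using mult[OF pow[of a b] update.IH] by (simp add: mult_single)
  qed
  show ?case
    using mult[OF const[of c] mon] by (simp add: dp_const_def mult_single)
next
  case (add p q)
  then show ?case by (rule assms(3))
qed

lemma dp_D_add: "dp_D (P + Q) = dp_D P + dp_D Q"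
  unfolding dp_D_def
  by (rule setsum_keys_plus_distrib)
     (simp_all add: distrib_right single_add sum.distrib)

text \<open>Summands outside \<open>keys m\<close> vanish because the exponent is zero there. The
  freedom in \<open>S\<close> lets \<open>m\<close>, \<open>k\<close> and \<open>m + k\<close> share
  one index set in the product rule.\<close>

lemma dp_D_single:
  assumes "finite S" "Poly_Mapping.keys m \<subseteq> S"
  shows "dp_D (Poly_Mapping.single m c) = (\<Sum>v\<in>S. Poly_Mapping.single
       (m - Poly_Mapping.single v 1 + Poly_Mapping.single (next_jet v) 1)
       (c * of_nat (Poly_Mapping.lookup m v)))"
proof -
  have "dp_D (Poly_Mapping.single m c) = (\<Sum>v\<in>Poly_Mapping.keys m. Poly_Mapping.single
       (m - Poly_Mapping.single v 1 + Poly_Mapping.single (next_jet v) 1)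
       (c * of_nat (Poly_Mapping.lookup m v)))"
    by (simp add: dp_D_def)
  also have "\<dots> = (\<Sum>v\<in>S. Poly_Mapping.single
       (m - Poly_Mapping.single v 1 + Poly_Mapping.single (next_jet v) 1)
       (c * of_nat (Poly_Mapping.lookup m v)))"
    using assms by (intro sum.mono_neutral_left) (auto simp: in_keys_iff)
  finally show ?thesis .
qed

text \<open>Exponents are subtracted with truncation at zero, so in general \<open>k\<close> can be
  moved out only where \<open>v\<close> occurs in \<open>m\<close>.\<close>

lemma add_diff_single:
  fixes m k :: "'a \<Rightarrow>\<^sub>0 nat"
  assumes "Poly_Mapping.lookup m v \<noteq> 0"
  shows "m + k - Poly_Mapping.single v 1 = (m - Poly_Mapping.single v 1) + k"
  using assms
  by (intro poly_mapping_eqI) (auto simp: lookup_add lookup_minus lookup_single when_def)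

lemma dp_D_mult_single:
  fixes c d :: complex
  shows "dp_D (Poly_Mapping.single m c * Poly_Mapping.single k d)
    = dp_D (Poly_Mapping.single m c) * Poly_Mapping.single k d
    + Poly_Mapping.single m c * dp_D (Poly_Mapping.single k d)"
proof -
  define S where "S = Poly_Mapping.keys m \<union> Poly_Mapping.keys k"
  have S: "finite S" "Poly_Mapping.keys m \<subseteq> S" "Poly_Mapping.keys k \<subseteq> S"
      "Poly_Mapping.keys (m + k) \<subseteq> S"
    using Poly_Mapping.keys_add[of m k] by (auto simp: S_def)
  let ?t = "\<lambda>m v. m - Poly_Mapping.single v 1 + Poly_Mapping.single (next_jet v) 1"
  have "Poly_Mapping.single (?t (m + k) v) (c * d * of_nat (Poly_Mapping.lookup (m + k) v))
     = Poly_Mapping.single (?t m v) (c * of_nat (Poly_Mapping.lookup m v)) * Poly_Mapping.single k d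
     + Poly_Mapping.single m c * Poly_Mapping.single (?t k v) (d * of_nat (Poly_Mapping.lookup k v))"
    for v
  proof -
    \<comment> \<open>If \<open>v\<close> does not occur in \<open>m\<close>, the truncated
      exponents may disagree, but then both coefficients are zero.\<close>
    have 1: "Poly_Mapping.single (?t (m + k) v) (c * d * of_nat (Poly_Mapping.lookup m v))
      = Poly_Mapping.single (?t m v) (c * of_nat (Poly_Mapping.lookup m v)) * Poly_Mapping.single k d"
      using add_diff_single[of m v k]
      by (cases "Poly_Mapping.lookup m v = 0") (simp_all add: mult_single ac_simps)
    have 2: "Poly_Mapping.single (?t (m + k) v) (c * d * of_nat (Poly_Mapping.lookup k v))
      = Poly_Mapping.single m c * Poly_Mapping.single (?t k v) (d * of_nat (Poly_Mapping.lookup k v))"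
      using add_diff_single[of k v m]
      by (cases "Poly_Mapping.lookup k v = 0") (simp_all add: mult_single ac_simps)
    show ?thesis
      unfolding 1[symmetric] 2[symmetric]
      by (simp add: lookup_add distrib_left flip: single_add)
  qed
  then show ?thesis
    using S by (simp add: mult_single dp_D_single[where S=S] sum_distrib_right sum_distrib_left
        flip: sum.distrib)
qed

lemma dp_D_mult: "dp_D (P * Q) = dp_D P * Q + P * dp_D Q"
proof (induction P rule: dpoly_induct)
  case (single m c)
  show ?case
  proof (induction Q rule: dpoly_induct)
    case (single k d)
    show ?case by (rule dp_D_mult_single)
  next
    case (add p q)
    then show ?case by (simp add: distrib_left dp_D_add)
  qed
next
  case (add p q)
  then show ?case by (simp add: distrib_right dp_D_add)
qed

lemma dp_D_const [simp]: "dp_D (dp_const c) = 0"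
  by (simp add: dp_D_def dp_const_def)

lemma dp_D_var [simp]: "dp_D (dp_var v) = dp_var (next_jet v)"
  by (simp add: dp_D_def dp_var_def)

lemma dp_const_mult: "dp_const a * dp_const b = dp_const (a * b)"
  by (simp add: dp_const_def mult_single)

lemma dp_const_numeral [simp]: "dp_const (numeral w) = numeral w" "dp_const 1 = 1"
  by (simp_all add: dp_const_def)

section \<open>Evaluation as a ring homomorphism\<close>

lemma dp_eval_add: "dp_eval e f (P + Q) x = dp_eval e f P x + dp_eval e f Q x"
  unfolding dp_eval_def
  by (rule setsum_keys_plus_distrib) (simp_all add: distrib_right)

lemma dp_eval_single:
  assumes "finite S" "Poly_Mapping.keys m \<subseteq> S"
  shows "dp_eval e f (Poly_Mapping.single m c) x
    = c * (\<Prod>v\<in>S. jet_value e f x v ^ Poly_Mapping.lookup m v)"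
proof -
  have "dp_eval e f (Poly_Mapping.single m c) x
    = c * (\<Prod>v\<in>Poly_Mapping.keys m. jet_value e f x v ^ Poly_Mapping.lookup m v)"
    by (simp add: dp_eval_def)
  also have "\<dots> = c * (\<Prod>v\<in>S. jet_value e f x v ^ Poly_Mapping.lookup m v)"
    using assms by (intro arg_cong2[of _ _ _ _ "(*)"] prod.mono_neutral_left) (auto simp: in_keys_iff)
  finally show ?thesis .
qed

lemma dp_eval_mult: "dp_eval e f (P * Q) x = dp_eval e f P x * dp_eval e f Q x"
proof (induction P rule: dpoly_induct)
  case (single m c)
  show ?case
  proof (induction Q rule: dpoly_induct)
    case (single k d)
    define S where "S = Poly_Mapping.keys m \<union> Poly_Mapping.keys k"
    have S: "finite S" "Poly_Mapping.keys m \<subseteq> S" "Poly_Mapping.keys k \<subseteq> S"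
        "Poly_Mapping.keys (m + k) \<subseteq> S"
      using Poly_Mapping.keys_add[of m k] by (auto simp: S_def)
    then show ?case
      by (simp add: mult_single dp_eval_single[where S=S] lookup_add power_add prod.distrib)
  next
    case (add p q)
    then show ?case by (simp add: distrib_left dp_eval_add)
  qed
next
  case (add p q)
  then show ?case by (simp add: distrib_right dp_eval_add)
qed

lemma dp_eval_const [simp]: "dp_eval e f (dp_const c) x = c"
  by (simp add: dp_eval_def dp_const_def)

lemma dp_eval_var [simp]: "dp_eval e f (dp_var v) x = jet_value e f x v"
  by (simp add: dp_eval_def dp_var_def)

lemma dp_eval_numeral [simp]: "dp_eval e f (numeral w) x = numeral w"
  by (metis dp_const_numeral(1) dp_eval_const)

lemma dp_eval_minus: "dp_eval e f (- P) x = - dp_eval e f P x"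
  by (metis add_eq_0_iff dp_eval_add dp_eval_const dp_const_def single_zero ab_left_minus)

section \<open>Exactness of the recursion\<close>

definition fps_map :: "('a \<Rightarrow> 'a) \<Rightarrow> 'a::zero fps \<Rightarrow> 'a fps" where
  "fps_map D f = Abs_fps (\<lambda>n. D (fps_nth f n))"

lemma fps_map_nth [simp]: "fps_nth (fps_map D f) n = D (fps_nth f n)"
  by (simp add: fps_map_def)

lemma numeral_mult_fps_nth: "fps_nth (numeral w * f) n = numeral w * fps_nth (f :: 'a::comm_ring_1 fps) n"
  by (simp add: numeral_fps_const)

text \<open>Abstract because two derivations occur: \<open>dp_D\<close> on differential polynomials,
  and its coefficientwise extension to power series in X, for which X is a constant.\<close>

locale derivation =
  fixes D :: "'a::comm_ring_1 \<Rightarrow> 'a"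
  assumes add: "D (x + y) = D x + D y"
    and mult: "D (x * y) = D x * y + x * D y"
begin

lemma zero [simp]: "D 0 = 0"
  using add[of 0 0] by simp

lemma minus: "D (- x) = - D x"
  using add[of x "- x"] by (simp add: eq_neg_iff_add_eq_0 add.commute)

lemma diff: "D (x - y) = D x - D y"
  using add[of x "- y"] by (simp add: minus)

lemma sum: "D (\<Sum>x\<in>S. f x) = (\<Sum>x\<in>S. D (f x))"
  by (induction S rule: infinite_finite_induct) (simp_all add: add)

lemma one [simp]: "D 1 = 0"
  using mult[of 1 1] by simp

lemma numeral [simp]: "D (numeral w) = 0"
  by (induction w) (simp_all only: numeral.simps add one add_0_left)

lemma fps_map: "derivation (fps_map D)"
proof
  fix x y :: "'a fps"
  show "fps_map D (x + y) = fps_map D x + fps_map D y"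
    by (rule fps_ext) (simp add: add)
  show "fps_map D (x * y) = fps_map D x * y + x * fps_map D y"
    by (rule fps_ext) (simp add: fps_mult_nth sum mult sum.distrib)
qed

text \<open>The coefficient of X^k on the left-hand side of the equation for the generating series
  of \<open>A\<close>. The guards express that coefficients of negative index are zero; truncated
  subtraction alone would return \<open>A 0\<close>.\<close>

definition res :: "'a \<Rightarrow> 'a \<Rightarrow> (nat \<Rightarrow> 'a) \<Rightarrow> nat \<Rightarrow> 'a" where
  "res E F A k = 4 * D (A k)
    - 2 * (if k < 1 then 0 else D E * A (k - 1) + 2 * E * D (A (k - 1)))
    - 2 * (if k < 2 then 0 else D F * A (k - 2) + 2 * F * D (A (k - 2)))
    + (if k < 2 then 0 else D (D (D (A (k - 2)))))"

text \<open>In the proof, \<open>P\<close> is \<open>\<Phi>\<close>, \<open>R\<close> is the left-hand side of its equation, and \<open>G\<close> is the integral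
  of \<open>2 \<Phi> R\<close>.  As \<open>A\<^sub>0 = 2\<close>, the coefficient of \<open>2 \<Phi> R\<close> at \<open>X\<^sup>j\<close> is \<open>4 R\<^sub>j\<close> once the lower \<open>R\<^sub>k\<close> vanish.\<close>

lemma res_exact:
  assumes A0: "A 0 = 2" and res0: "\<And>k. k < j \<Longrightarrow> res E F A k = 0"
  shows "\<exists>G. D G = 4 * res E F A j"
proof -
  interpret fps: derivation "fps_map D" by (rule fps_map)
  let ?D = "fps_map D"
  define P where "P = Abs_fps A"
  define X where "X = (fps_X :: 'a fps)"
  have DX: "?D X = 0"
    by (rule fps_ext) (simp add: X_def fps_X_def)
  have Dc: "?D (fps_const c) = fps_const (D c)" for c
    by (rule fps_ext) simp
  define R where "R = 4 * ?D P - 2 * (X * (fps_const (D E) * P + 2 * (fps_const E * ?D P)))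
    - 2 * (X * (X * (fps_const (D F) * P + 2 * (fps_const F * ?D P)))) + X * (X * ?D (?D (?D P)))"
  define G where "G = X * X * (2 * (P * ?D (?D P)) - ?D P * ?D P)
     + 4 * ((1 - X * fps_const E - X * X * fps_const F) * (P * P))"
  have R_nth: "fps_nth R k = res E F A k" for k
    by (simp add: R_def res_def X_def P_def numeral_mult_fps_nth numeral_2_eq_2)
  have "?D G = 2 * (P * R)"
    unfolding G_def R_def
    by (simp add: fps.add fps.mult fps.diff DX Dc) (simp add: algebra_simps)
  then have "D (fps_nth G j) = 2 * fps_nth (P * R) j"
    by (metis fps_map_nth numeral_mult_fps_nth)
  also have "fps_nth (P * R) j = (\<Sum>i=0..j. A i * res E F A (j - i))"
    by (simp add: fps_mult_nth R_nth) (simp add: P_def)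
  also have "\<dots> = (\<Sum>i\<in>{0}. A i * res E F A (j - i))"
    by (rule sum.mono_neutral_right) (auto simp: res0)
  finally show ?thesis
    using A0 by (auto simp: mult.assoc[symmetric])
qed

end

interpretation dp: derivation dp_D
  by standard (rule dp_D_add dp_D_mult)+

lemma lookup_dp_const: "Poly_Mapping.lookup (dp_const c) m = (if m = 0 then c else 0)"
  by (auto simp: dp_const_def lookup_single when_def)

text \<open>Any antiderivative will do: \<^const>\<open>dp_int\<close> need not be shown to be unique.\<close>

lemma dp_D_int:
  assumes "dp_D Q = P"
  shows "dp_D (dp_int P) = P"
proof -
  have "\<exists>Q. dp_D Q = P \<and> Poly_Mapping.lookup Q 0 = 0"
    using assms
    by (intro exI[of _ "Q - dp_const (Poly_Mapping.lookup Q 0)"])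
       (simp add: dp.diff lookup_minus lookup_dp_const)
  from someI_ex[OF this] show ?thesis
    unfolding dp_int_def by blast
qed

lemma dp_const_cancel: "dp_const (1 / numeral w) * (numeral w * P) = P"
proof -
  have "dp_const (1 / numeral w) * numeral w = (1 :: dpoly)"
    using dp_const_mult[of "1 / numeral w" "numeral w"] by simp
  then show ?thesis by (simp flip: mult.assoc)
qed

lemma dp_D_const_mult: "dp_D (dp_const c * P) = dp_const c * dp_D P"
  by (simp add: dp.mult)

text \<open>\<open>res_exact\<close> constrains only the residuals below \<open>j\<close>, so it
  makes the residual at \<open>j\<close> exact whatever polynomial \<open>dpA j\<close> is. The
  other terms of that residual are exact except for the integrand, so the integrand is exact too.
  Only then is \<open>dp_int\<close> known to integrate it, and the recursion gives residual
  zero.\<close>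

lemma dpA_res: "dp.res (dp_var (JE 0)) (dp_var (JF 0)) dpA j = 0"
proof (induction j rule: less_induct)
  case (less j)
  let ?E = "dp_var (JE 0)" and ?F = "dp_var (JF 0)"
  have four: "4 * P = 2 * (2 * P)" for P :: dpoly
    by (simp flip: mult.assoc)
  define R where "R = dp.res ?E ?F dpA j"
  obtain G where "dp_D G = 4 * R"
    unfolding R_def using dp.res_exact[of dpA j ?E ?F] less by auto
  then have "dp_D (dp_const (1/4) * G) = R"
    by (simp add: dp_D_const_mult dp_const_cancel)
  then obtain H where H: "dp_D H = R" by blast
  consider "j = 0" | "j = Suc 0" | i where "j = Suc (Suc i)"
    by (metis not0_implies_Suc)
  then show ?case
  proof cases
    case 1
    then show ?thesis by (simp add: dp.res_def)
  next
    case 2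
    define S where "S = dp_bracket ?E (dpA 0)"
    have R: "R = 4 * dp_D (dpA 1) - 2 * S"
      by (simp add: R_def 2 dp.res_def S_def dp_bracket_def)
    \<comment> \<open>The antiderivative of \<open>S\<close> is found by solving the formula for
      \<open>R\<close> for \<open>S\<close>, with \<open>H\<close> in place of the integral of
      \<open>R\<close>.\<close>
    have "dp_D (dp_const (1/2) * (4 * dpA 1 - H)) = dp_const (1/2) * (2 * S)"
      by (simp add: dp_D_const_mult dp.diff dp.mult H R)
    then have "dp_D (dp_int S) = S"
      by (intro dp_D_int) (simp add: dp_const_cancel)
    then have "2 * dp_D (dpA 1) = 2 * (dp_const (1/2) * S)"
      by (simp add: dp_D_const_mult S_def)
    also have "\<dots> = S"
      using dp_const_cancel[of _ S] by (simp add: mult.left_commute)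
    finally have "4 * dp_D (dpA 1) = 2 * S"
      using arg_cong[of _ S "\<lambda>x. 2 * x"] four by metis
    then have "R = 0"
      unfolding R by (simp only: diff_self)
    then show ?thesis by (simp add: R_def)
  next
    case 3
    define S where "S = dp_bracket ?E (dpA (Suc i)) + dp_bracket ?F (dpA i)"
    let ?T = "dp_D (dp_D (dp_D (dpA i)))"
    have R: "R = 4 * dp_D (dpA j) - 2 * S + ?T"
      by (simp add: R_def 3 dp.res_def S_def dp_bracket_def algebra_simps)
    have "dp_D (dp_const (1/2) * (4 * dpA j - H + dp_D (dp_D (dpA i)))) = dp_const (1/2) * (2 * S)"
      by (simp add: dp_D_const_mult dp.diff dp.add dp.mult H R)
    then have "dp_D (dp_int S) = S"
      by (intro dp_D_int) (simp add: dp_const_cancel)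
    then have "dp_D (dpA j) = dp_const (1/2) * S - dp_const (1/4) * ?T"
      by (simp add: dp_D_const_mult S_def 3 dp.diff)
    moreover have "2 * (dp_const (1/2) * S) = S" "4 * (dp_const (1/4) * ?T) = ?T"
      by (simp_all add: mult.left_commute[of _ "dp_const _"] dp_const_cancel)
    ultimately have "4 * dp_D (dpA j) = 2 * S - ?T"
      by (metis four right_diff_distrib)
    then have "R = 0"
      unfolding R by (simp only: diff_add_cancel diff_self diff_diff_eq2 cancel_comm_monoid_add_class.diff_cancel) simp
    then show ?thesis by (simp add: R_def)
  qed
qed

section \<open>Smooth functions\<close>

lemma dx_eqI: "(f has_vector_derivative d) (at x) \<Longrightarrow> dx f x = d"
  unfolding dx_def by (rule vector_derivative_at)

lemma has_dx: "f differentiable (at x) \<Longrightarrow> (f has_vector_derivative dx f x) (at x)"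
  unfolding dx_def by (rule vector_derivative_works[THEN iffD1])

lemma has_vector_derivative_differentiable:
  "(f has_vector_derivative d) (at x) \<Longrightarrow> f differentiable (at x)"
  by (rule differentiableI_vector)

text \<open>Finite order makes induction possible: the derivative of a product or an inverse is
  built from functions that have at least one order less.\<close>

definition diff_on :: "nat \<Rightarrow> real set \<Rightarrow> (real \<Rightarrow> complex) \<Rightarrow> bool" where
  "diff_on k I f \<longleftrightarrow> (\<forall>j<k. \<forall>x\<in>I. (dx ^^ j) f differentiable (at x))"

lemma smooth_on_iff: "smooth_on I f \<longleftrightarrow> (\<forall>k. diff_on k I f)"
  unfolding smooth_on_def diff_on_def by blast

lemma diff_on_0 [simp]: "diff_on 0 I f"
  by (simp add: diff_on_def)

lemma diff_on_Suc: "diff_on (Suc k) I f \<longleftrightarrow> (\<forall>x\<in>I. f differentiable (at x)) \<and> diff_on k I (dx f)"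
  by (simp add: diff_on_def All_less_Suc2 funpow_Suc_right del: funpow.simps)

lemma diff_on_SucD: "diff_on (Suc k) I f \<Longrightarrow> diff_on k I f"
  by (simp add: diff_on_def)

lemma dx_cong:
  assumes "open I" "x \<in> I" "\<And>y. y \<in> I \<Longrightarrow> f y = g y"
  shows "dx f x = dx g x"
proof -
  have "eventually (\<lambda>y. y \<in> I) (nhds x)"
    using assms by (simp add: eventually_nhds_in_open)
  then have "eventually (\<lambda>y. f y = g y) (nhds x)"
    by (rule eventually_mono) (rule assms(3))
  then show ?thesis
    unfolding dx_def by (intro vector_derivative_cong_eq) (auto simp: assms)
qed

lemma differentiable_cong:
  fixes f g :: "real \<Rightarrow> complex"
  assumes "open I" "x \<in> I" "\<And>y. y \<in> I \<Longrightarrow> f y = g y" "f differentiable (at x)"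
  shows "g differentiable (at x)"
  using has_vector_derivative_transform_within_open[OF has_dx[OF assms(4)] assms(1,2,3)]
  by (rule has_vector_derivative_differentiable)

lemma diff_on_cong:
  assumes "open I" "\<And>x. x \<in> I \<Longrightarrow> f x = g x" "diff_on k I f"
  shows "diff_on k I g"
  using assms(2,3)
proof (induction k arbitrary: f g)
  case (Suc k)
  have "\<forall>x\<in>I. g differentiable (at x)"
    using Suc.prems differentiable_cong[OF assms(1)] by (fastforce simp: diff_on_Suc)
  moreover have "diff_on k I (dx g)"
  proof (rule Suc.IH[of "dx f"])
    show "dx f x = dx g x" if "x \<in> I" for x
      using dx_cong[OF assms(1) that] Suc.prems(1) by blast
    show "diff_on k I (dx f)"
      using Suc.prems by (simp add: diff_on_Suc)
  qed
  ultimately show ?case by (simp add: diff_on_Suc)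
qed simp

text \<open>Lets each closure proof give the derivative by a formula \<open>g\<close> that is valid
  on \<open>I\<close> alone; \<open>dx f\<close> may differ from \<open>g\<close> elsewhere, which
  is harmless because \<open>I\<close> is open.\<close>

lemma diff_on_SucI:
  assumes "open I" "\<And>x. x \<in> I \<Longrightarrow> (f has_vector_derivative g x) (at x)" "diff_on k I g"
  shows "diff_on (Suc k) I f"
proof -
  have "diff_on k I (dx f)"
    by (rule diff_on_cong[OF assms(1) _ assms(3)]) (simp add: dx_eqI[OF assms(2)])
  then show ?thesis
    using assms(2) has_vector_derivative_differentiable by (auto simp: diff_on_Suc)
qed

lemma diff_on_SucE:
  assumes "diff_on (Suc k) I f"
  shows "\<And>x. x \<in> I \<Longrightarrow> (f has_vector_derivative dx f x) (at x)" "diff_on k I (dx f)" "diff_on k I f"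
  using assms has_dx diff_on_SucD by (auto simp: diff_on_Suc)

lemma diff_on_const: "open I \<Longrightarrow> diff_on k I (\<lambda>_. c)"
proof (induction k arbitrary: c)
  case (Suc k)
  then show ?case by (intro diff_on_SucI[where g="\<lambda>_. 0"]) auto
qed simp

lemma diff_on_add: "open I \<Longrightarrow> diff_on k I f \<Longrightarrow> diff_on k I g \<Longrightarrow> diff_on k I (\<lambda>x. f x + g x)"
proof (induction k arbitrary: f g)
  case (Suc k)
  note f = diff_on_SucE[OF Suc.prems(2)] and g = diff_on_SucE[OF Suc.prems(3)]
  show ?case
    by (rule diff_on_SucI[where g="\<lambda>x. dx f x + dx g x", OF Suc.prems(1)])
       (rule has_vector_derivative_add Suc.IH f g Suc.prems(1) | assumption)+
qed simp

lemma diff_on_mult: "open I \<Longrightarrow> diff_on k I f \<Longrightarrow> diff_on k I g \<Longrightarrow> diff_on k I (\<lambda>x. f x * g x)"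
proof (induction k arbitrary: f g)
  case (Suc k)
  note f = diff_on_SucE[OF Suc.prems(2)] and g = diff_on_SucE[OF Suc.prems(3)]
  show ?case
    by (rule diff_on_SucI[where g="\<lambda>x. f x * dx g x + dx f x * g x", OF Suc.prems(1)])
       (rule has_vector_derivative_mult diff_on_add Suc.IH f g Suc.prems(1) | assumption)+
qed simp

lemma diff_on_cnj: "open I \<Longrightarrow> diff_on k I f \<Longrightarrow> diff_on k I (\<lambda>x. cnj (f x))"
proof (induction k arbitrary: f)
  case (Suc k)
  note f = diff_on_SucE[OF Suc.prems(2)]
  show ?case
    by (rule diff_on_SucI[where g="\<lambda>x. cnj (dx f x)", OF Suc.prems(1)])
       (rule has_vector_derivative_cnj Suc.IH f Suc.prems(1) | assumption)+
qed simp

lemma diff_on_inverse: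
  "open I \<Longrightarrow> diff_on k I f \<Longrightarrow> \<forall>x\<in>I. f x \<noteq> 0 \<Longrightarrow> diff_on k I (\<lambda>x. inverse (f x))"
proof (induction k)
  case (Suc k)
  note f = diff_on_SucE[OF Suc.prems(2)]
  \<comment> \<open>The derivative is a product with factors \<open>inverse (f x)\<close>, so that
    the induction hypothesis applies to it.\<close>
  have "((\<lambda>x. inverse (f x)) has_vector_derivative
      dx f x * (- 1 * (inverse (f x) * inverse (f x)))) (at x)" if "x \<in> I" for x
    using field_vector_diff_chain_at[OF f(1)[OF that] DERIV_inverse[of "f x" UNIV]] Suc.prems(3) that
    by (simp add: o_def power2_eq_square numeral_2_eq_2)
  then show ?case
    by (rule diff_on_SucI[OF Suc.prems(1)])
       (rule diff_on_mult diff_on_const Suc.IH f Suc.prems | assumption)+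
qed simp

lemma smooth_on_dx: "smooth_on I f \<Longrightarrow> smooth_on I (dx f)"
  unfolding smooth_on_iff using diff_on_SucE(2) by blast

lemma smooth_on_has_dx: "smooth_on I f \<Longrightarrow> x \<in> I \<Longrightarrow> (f has_vector_derivative dx f x) (at x)"
  unfolding smooth_on_iff using diff_on_SucE(1) by blast

lemma smooth_on_isCont: "smooth_on I f \<Longrightarrow> x \<in> I \<Longrightarrow> isCont f x"
  using smooth_on_has_dx has_vector_derivative_continuous by blast

lemma smooth_on_Efun:
  assumes "open I" "smooth_on I q" "\<forall>x\<in>I. q x \<noteq> 0"
  shows "smooth_on I (Efun q)"
proof -
  have "smooth_on I (\<lambda>x. \<i> * dx q x * inverse (q x))"
    using assms smooth_on_dx[OF assms(2)] unfolding smooth_on_iff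
    by (intro allI diff_on_mult diff_on_const diff_on_inverse) auto
  then show ?thesis
    by (simp add: Efun_def[abs_def] divide_inverse)
qed

lemma smooth_on_Ffun:
  assumes "open I" "smooth_on I q" "\<forall>x\<in>I. q x \<noteq> 0"
  shows "smooth_on I (Ffun \<sigma> q)"
proof -
  \<comment> \<open>The squared modulus becomes q times its conjugate, a product of smooth
    functions.\<close>
  have "Ffun \<sigma> q = (\<lambda>x. - (1/4) * (Efun q x * Efun q x) + (- of_real \<sigma> * (q x * cnj (q x)) + \<i> / 2 * dx (Efun q) x))"
    by (rule ext) (simp only: Ffun_def of_real_mult complex_norm_square, simp add: power2_eq_square)
  moreover have "smooth_on I \<dots>"
    using assms smooth_on_dx[OF smooth_on_Efun[OF assms]] smooth_on_Efun[OF assms]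
    unfolding smooth_on_iff
    by (intro allI diff_on_add diff_on_mult diff_on_const diff_on_cnj) blast+
  ultimately show ?thesis by simp
qed

text \<open>Formal and actual derivative obey the same sum and product rules, so generators suffice;
  for these the claim is the definition of \<open>jet_value\<close>. This carries identities such as
  \<open>dpA_res\<close> over to functions.\<close>

lemma has_dx_dp_eval:
  assumes "smooth_on I e" "smooth_on I f" "x \<in> I"
  shows "(dp_eval e f P has_vector_derivative dp_eval e f (dp_D P) x) (at x)"
proof (induction P rule: dpoly_ring_induct)
  case (const c)
  have "dp_eval e f (dp_const c) = (\<lambda>_. c)" "dp_eval e f 0 x = 0"
    by (rule ext) (simp_all add: dp_eval_def[of _ _ 0])
  then show ?case by simp
next
  case (var v)
  have "dp_eval e f (dp_var v) = (\<lambda>x. jet_value e f x v)"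
    by (rule ext) simp
  then show ?case
    using assms by (cases v) (auto simp: smooth_on_def intro: has_dx)
next
  case (add p q)
  have "dp_eval e f (p + q) = (\<lambda>x. dp_eval e f p x + dp_eval e f q x)"
    by (rule ext) (rule dp_eval_add)
  then show ?case
    using has_vector_derivative_add[OF add] by (simp add: dp_D_add dp_eval_add)
next
  case (mult p q)
  have "dp_eval e f (p * q) = (\<lambda>x. dp_eval e f p x * dp_eval e f q x)"
    by (rule ext) (rule dp_eval_mult)
  then show ?case
    using has_vector_derivative_mult[OF mult]
    by (simp add: dp_D_mult dp_eval_add dp_eval_mult add.commute)
qed

lemma smooth_on_dp_eval:
  assumes "open I" "smooth_on I e" "smooth_on I f"
  shows "smooth_on I (dp_eval e f P)"
proof -
  have "diff_on k I (dp_eval e f P)" for k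
  \<comment> \<open>The derivative is again an evaluation, but of \<open>dp_D P\<close>, so
    \<open>P\<close> must vary.\<close>
  proof (induction k arbitrary: P)
    case (Suc k)
    show ?case
      using has_dx_dp_eval[OF assms(2,3)] Suc by (rule diff_on_SucI[OF assms(1)])
  qed simp
  then show ?thesis by (simp add: smooth_on_iff)
qed

section \<open>The soliton recursion\<close>

lemma dx_zero [simp]: "dx (\<lambda>_. 0) = (\<lambda>_. 0)"
  by (rule ext, rule dx_eqI) simp

lemma prev_0 [simp]: "prev C 0 = (\<lambda>_. 0)" and prev_Suc [simp]: "prev C (Suc k) = C k"
  by (simp_all add: prev_def)

text \<open>For k \<le> n this is the coefficient of \<lambda>^(n + 2 - k) in the soliton equation,
  and the counterpart of \<open>dp.res\<close> for functions. The double \<open>prev\<close> yields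
  the coefficient of index k - 2, or zero.\<close>

definition soliton_res ::
  "(real \<Rightarrow> complex) \<Rightarrow> (real \<Rightarrow> complex) \<Rightarrow> (nat \<Rightarrow> real \<Rightarrow> complex) \<Rightarrow> nat \<Rightarrow> real \<Rightarrow> complex" where
  "soliton_res E F C k x = 4 * dx (C k) x - 2 * bracket E (prev C k) x
     - 2 * bracket F (prev (prev C) k) x + dx (dx (dx (prev (prev C) k))) x"

section \<open>Linearity of derivatives and brackets\<close>

lemma has_dx_lin:
  fixes f :: "'i \<Rightarrow> real \<Rightarrow> complex"
  assumes "\<And>j. j \<in> S \<Longrightarrow> (f j has_vector_derivative f' j) (at x)"
  shows "((\<lambda>x. \<Sum>j\<in>S. c j * f j x) has_vector_derivative (\<Sum>j\<in>S. c j * f' j)) (at x)"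
  by (intro has_vector_derivative_sum has_vector_derivative_mult_right assms)

lemma dx_lin:
  assumes "open I" "x \<in> I" "\<And>y. y \<in> I \<Longrightarrow> C y = (\<Sum>j\<in>S. c j * f j y)"
    and "\<And>j. j \<in> S \<Longrightarrow> smooth_on I (f j)"
  shows "dx C x = (\<Sum>j\<in>S. c j * dx (f j) x)"
proof -
  have "dx C x = dx (\<lambda>y. \<Sum>j\<in>S. c j * f j y) x"
    using assms by (intro dx_cong[of I]) auto
  also have "\<dots> = (\<Sum>j\<in>S. c j * dx (f j) x)"
    by (intro dx_eqI has_dx_lin smooth_on_has_dx[OF assms(4) assms(2)])
  finally show ?thesis .
qed

lemma bracket_lin:
  assumes "open I" "x \<in> I" "\<And>y. y \<in> I \<Longrightarrow> C y = (\<Sum>j\<in>S. c j * f j y)"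
    and "\<And>j. j \<in> S \<Longrightarrow> smooth_on I (f j)"
  shows "bracket E C x = (\<Sum>j\<in>S. c j * bracket E (f j) x)"
  using assms(2,3) dx_lin[OF assms]
  by (simp add: bracket_def sum_distrib_left sum.distrib algebra_simps)

lemma dx2_lin:
  assumes "open I" "x \<in> I" "\<And>y. y \<in> I \<Longrightarrow> C y = (\<Sum>j\<in>S. c j * f j y)"
    and "\<And>j. j \<in> S \<Longrightarrow> smooth_on I (f j)"
  shows "dx (dx C) x = (\<Sum>j\<in>S. c j * dx (dx (f j)) x)"
  by (rule dx_lin[OF assms(1,2)])
     (use dx_lin[OF assms(1) _ assms(3,4)] smooth_on_dx[OF assms(4)] in auto)

lemma dx3_lin:
  assumes "open I" "x \<in> I" "\<And>y. y \<in> I \<Longrightarrow> C y = (\<Sum>j\<in>S. c j * f j y)"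
    and "\<And>j. j \<in> S \<Longrightarrow> smooth_on I (f j)"
  shows "dx (dx (dx C)) x = (\<Sum>j\<in>S. c j * dx (dx (dx (f j))) x)"
  by (rule dx_lin[OF assms(1,2)])
     (use dx2_lin[OF assms(1) _ assms(3,4)] smooth_on_dx[OF smooth_on_dx[OF assms(4)]] in auto)

lemma smooth_on_zero: "open I \<Longrightarrow> smooth_on I (\<lambda>_. 0)"
  by (simp add: smooth_on_iff diff_on_const)

lemma smooth_on_prev: "open I \<Longrightarrow> \<forall>i\<le>n. smooth_on I (C i) \<Longrightarrow> i \<le> Suc n \<Longrightarrow> smooth_on I (prev C i)"
  by (cases i) (simp_all add: smooth_on_zero)

text \<open>An index shift commutes with convolution, since the extra summand j = i contains
  \<open>prev A 0\<close>, which is zero. The bound grows from i < m to i \<le> m, so the lemma can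
  be applied twice.\<close>

lemma prev_conv:
  assumes "\<And>i. i < m \<Longrightarrow> C i x = (\<Sum>j\<le>i. \<alpha> j * A (i - j) x)" and "i \<le> m"
  shows "prev C i x = (\<Sum>j\<le>i. \<alpha> j * prev A (i - j) x)"
proof (cases i)
  case (Suc k)
  have "(\<Sum>j\<le>k. \<alpha> j * prev A (Suc k - j) x) = (\<Sum>j\<le>k. \<alpha> j * A (k - j) x)"
    by (intro sum.cong) (auto simp: Suc_diff_le)
  then show ?thesis using assms Suc by simp
qed simp

section \<open>Integrating the recursion\<close>

lemma constant_on_einterval:
  assumes "\<And>x. x \<in> einterval a b \<Longrightarrow> (f has_vector_derivative 0) (at x)"
  shows "\<exists>c::complex. \<forall>x\<in>einterval a b. f x = c"
proof -
  have "is_interval (einterval a b)"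
    unfolding is_interval_1
  proof (intro ballI allI impI)
    fix x y z :: real
    assume "x \<in> einterval a b" "y \<in> einterval a b" "x \<le> z \<and> z \<le> y"
    then show "z \<in> einterval a b"
      using less_le_trans[of a "ereal x" "ereal z"] le_less_trans[of "ereal z" "ereal y" b]
      by (simp add: einterval_iff)
  qed
  then have "convex (einterval a b)"
    by (simp add: is_interval_convex)
  from has_vector_derivative_zero_constant[OF this has_vector_derivative_at_within[OF assms]]
  show ?thesis by blast
qed

text \<open>Every term of the residual is linear and, by \<open>prev_conv\<close>, compatible with
  convolution by the constants \<alpha>.\<close>

lemma soliton_res_conv:
  fixes I :: "real set"
  assumes I: "open I" "x \<in> I" and sm: "\<And>i. smooth_on I (A i)"
    and C: "\<And>i y. i \<le> m \<Longrightarrow> y \<in> I \<Longrightarrow> C i y = (\<Sum>j\<le>i. \<alpha> j * A (i - j) y)"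
  shows "soliton_res E F C m x = (\<Sum>j\<le>m. \<alpha> j * soliton_res E F A (m - j) x)"
proof -
  have p: "prev C i y = (\<Sum>j\<le>i. \<alpha> j * prev A (i - j) y)" if "i \<le> m" "y \<in> I" for i y
    using C that by (intro prev_conv[of m C]) auto
  have pp: "prev (prev C) m y = (\<Sum>j\<le>m. \<alpha> j * prev (prev A) (m - j) y)" if "y \<in> I" for y
    using p that by (intro prev_conv[of m "prev C"]) auto
  have smp: "smooth_on I (prev A i)" for i
    using smooth_on_prev[OF I(1), of i A i] sm by simp
  have smpp: "smooth_on I (prev (prev A) i)" for i
    using smooth_on_prev[OF I(1), of i "prev A" i] smp by simp
  have 1: "dx (C m) x = (\<Sum>j\<le>m. \<alpha> j * dx (A (m - j)) x)"
    using I C sm by (intro dx_lin[of I]) auto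
  have 2: "bracket E (prev C m) x = (\<Sum>j\<le>m. \<alpha> j * bracket E (prev A (m - j)) x)"
    using I p smp by (intro bracket_lin[of I]) auto
  have 3: "bracket F (prev (prev C) m) x = (\<Sum>j\<le>m. \<alpha> j * bracket F (prev (prev A) (m - j)) x)"
    using I pp smpp by (intro bracket_lin[of I]) auto
  have 4: "dx (dx (dx (prev (prev C) m))) x = (\<Sum>j\<le>m. \<alpha> j * dx (dx (dx (prev (prev A) (m - j)))) x)"
    using I pp smpp by (intro dx3_lin[of I]) auto
  show ?thesis
    unfolding soliton_res_def 1 2 3 4
    by (simp add: sum_distrib_left sum.distrib sum_subtractf algebra_simps)
qed

text \<open>Given the expansion below \<open>m\<close>, the m-th equation involves
  \<open>B m\<close> only through its derivative. The convolution \<open>h\<close> solves the same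
  equation, so \<open>B m - h\<close> is constant on the interval, and a change of \<alpha> at
  \<open>m\<close> absorbs it.\<close>

lemma soliton_res_expansion:
  assumes I: "I = einterval a b" and smA: "\<And>i. smooth_on I (A i)"
    and A0: "\<And>x. A 0 x = 2" and resA: "\<And>i x. x \<in> I \<Longrightarrow> soliton_res E F A i x = 0"
    and smB: "\<And>i. i < m \<Longrightarrow> smooth_on I (B i)"
    and resB: "\<And>i x. i < m \<Longrightarrow> x \<in> I \<Longrightarrow> soliton_res E F B i x = 0"
  shows "\<exists>\<alpha>. \<forall>i<m. \<forall>x\<in>I. B i x = (\<Sum>j\<le>i. \<alpha> j * A (i - j) x)"
  using smB resB
proof (induction m)
  case (Suc m)
  have op: "open I" using I by simp
  obtain \<alpha> where \<alpha>: "\<And>i x. i < m \<Longrightarrow> x \<in> I \<Longrightarrow> B i x = (\<Sum>j\<le>i. \<alpha> j * A (i - j) x)"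
    using Suc by (metis less_Suc_eq)
  define h where "h = (\<lambda>x. \<Sum>j\<le>m. \<alpha> j * A (m - j) x)"
  \<comment> \<open>\<open>C\<close> shares with \<open>B\<close> all coefficients but the m-th, so
    the two residuals at \<open>m\<close> differ only in the term \<open>4 * dx\<close>.\<close>
  define C where "C = B(m := h)"
  have C: "C i y = (\<Sum>j\<le>i. \<alpha> j * A (i - j) y)" if "i \<le> m" "y \<in> I" for i y
    using that \<alpha> by (auto simp: C_def h_def)
  have prev_eq: "prev C m = prev B m" "prev (prev C) m = prev (prev B) m"
    by (auto simp: C_def prev_def split: nat.split)
  have dx_eq: "dx (B m) x = dx h x" if x: "x \<in> I" for x
  proof -
    have "soliton_res E F C m x = 0"
      using soliton_res_conv[OF op x smA C, where E=E and F=F] resA[OF x] by simp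
    moreover have "soliton_res E F B m x = 0"
      using Suc.prems(2) x by simp
    moreover have "p = r" if "4 * p - u - v + w = 0" "4 * r - u - v + w = 0" for p r u v w :: complex
      using that by algebra
    ultimately have "dx (C m) x = dx (B m) x"
      unfolding soliton_res_def prev_eq by blast
    then show ?thesis by (simp add: C_def)
  qed
  have "((\<lambda>x. B m x - h x) has_vector_derivative 0) (at x)" if "x \<in> I" for x
  proof -
    have "(h has_vector_derivative (\<Sum>j\<le>m. \<alpha> j * dx (A (m - j)) x)) (at x)"
      unfolding h_def by (rule has_dx_lin) (rule smooth_on_has_dx[OF smA that])
    then have "(h has_vector_derivative dx (B m) x) (at x)"
      by (simp add: dx_eq[OF that] dx_eqI)
    from has_vector_derivative_diff[OF smooth_on_has_dx[OF Suc.prems(1)[of m] that] this]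
    show ?thesis by simp
  qed
  then obtain d where d: "\<And>x. x \<in> I \<Longrightarrow> B m x - h x = d"
    using constant_on_einterval[of a b "\<lambda>x. B m x - h x"] I by blast
  \<comment> \<open>In the m-th convolution \<alpha> at \<open>m\<close> multiplies
    \<open>A 0 = 2\<close>, hence the half. Convolutions of lower index do not contain it.\<close>
  define \<alpha>' where "\<alpha>' = \<alpha>(m := \<alpha> m + d / 2)"
  have "B i x = (\<Sum>j\<le>i. \<alpha>' j * A (i - j) x)" if "i < Suc m" "x \<in> I" for i x
  proof (cases "i = m")
    case True
    have "(\<Sum>j\<le>m. \<alpha>' j * A (m - j) x) = (\<Sum>j\<le>m. \<alpha> j * A (m - j) x + (if j = m then d else 0))"
      by (intro sum.cong) (auto simp: \<alpha>'_def A0 algebra_simps)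
    also have "\<dots> = h x + d"
      by (simp add: sum.distrib h_def)
    also have "\<dots> = B m x"
      using d[OF that(2)] by (simp add: algebra_simps)
    finally show ?thesis using True by simp
  next
    case False
    then have "i < m" using that by simp
    then have "(\<Sum>j\<le>i. \<alpha>' j * A (i - j) x) = (\<Sum>j\<le>i. \<alpha> j * A (i - j) x)"
      by (intro sum.cong) (auto simp: \<alpha>'_def)
    then show ?thesis using \<alpha> \<open>i < m\<close> that by simp
  qed
  then show ?case by blast
qed simp

section \<open>The basic coefficients solve the recursion\<close>

lemma dp_eval_diff: "dp_eval e f (P - Q) x = dp_eval e f P x - dp_eval e f Q x"
  using dp_eval_add[of e f P "- Q" x] by (simp add: dp_eval_minus)

lemma dp_eval_zero [simp]: "dp_eval e f 0 x = 0"
  by (simp add: dp_eval_def)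

text \<open>This is \<open>dpA_res\<close> evaluated at E and F. The three cases match the guards in
  \<open>dp.res\<close> with the zero values of \<open>prev\<close>.\<close>

lemma soliton_res_Afun:
  assumes "open I" "smooth_on I q" "\<forall>x\<in>I. q x \<noteq> 0" "x \<in> I"
  shows "soliton_res (Efun q) (Ffun \<sigma> q) (Afun \<sigma> q) i x = 0"
proof -
  let ?ev = "dp_eval (Efun q) (Ffun \<sigma> q)"
  have ev: "(?ev P has_vector_derivative ?ev (dp_D P) y) (at y)" if "y \<in> I" for P y
    using has_dx_dp_eval[OF smooth_on_Efun[OF assms(1-3)] smooth_on_Ffun[OF assms(1-3)] that] .
  have dx1: "dx (?ev P) y = ?ev (dp_D P) y" if "y \<in> I" for P y
    by (rule dx_eqI[OF ev[OF that]])
  have dx2: "dx (dx (?ev P)) y = ?ev (dp_D (dp_D P)) y" if "y \<in> I" for P y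
    using dx_cong[OF assms(1) that dx1] dx1[OF that] by simp
  have dx3: "dx (dx (dx (?ev P))) y = ?ev (dp_D (dp_D (dp_D P))) y" if "y \<in> I" for P y
    using dx_cong[OF assms(1) that dx2] dx1[OF that] by simp
  have res: "?ev (dp.res (dp_var (JE 0)) (dp_var (JF 0)) dpA i) x = 0"
    by (simp add: dpA_res)
  consider "i = 0" | "i = Suc 0" | k where "i = Suc (Suc k)"
    by (metis not0_implies_Suc)
  then show ?thesis
  proof cases
    case 1
    then show ?thesis
      using assms(4) dx1[of x "2"] by (simp add: soliton_res_def Afun_def bracket_def)
  next
    case 2
    then show ?thesis
      using res dx1[OF assms(4)]
      by (simp add: soliton_res_def Afun_def bracket_def dp.res_def dp_eval_add dp_eval_diff dp_eval_mult
          del: dpA.simps)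
  next
    case 3
    then show ?thesis
      using res dx1[OF assms(4)] dx3[OF assms(4)]
      by (simp add: soliton_res_def Afun_def bracket_def dp.res_def dp_eval_add dp_eval_diff dp_eval_mult
          del: dpA.simps)
  qed
qed

section \<open>Comparing coefficients in \<lambda>\<close>

lemma rev_poly_eq_0:
  fixes c :: "nat \<Rightarrow> complex"
  assumes "\<And>z. (\<Sum>i\<le>N. c i * z ^ (N - i)) = 0" and "i \<le> N"
  shows "c i = 0"
proof -
  have "(\<Sum>i\<le>N. c (N - i) * z ^ i) = 0" for z
  proof -
    have "(\<Sum>i\<le>N. c (N - i) * z ^ i) = (\<Sum>i\<le>N. c i * z ^ (N - i))"
      by (rule sum.reindex_bij_witness[of _ "\<lambda>i. N - i" "\<lambda>i. N - i"]) auto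
    then show ?thesis using assms(1) by simp
  qed
  then have "c (N - (N - i)) = 0"
    using polyfun_eq_0[of "\<lambda>i. c (N - i)" N] by auto
  then show ?thesis using assms(2) by simp
qed

text \<open>With r = 2, the terms of the soliton equation with factors \<lambda>^2, \<lambda> and 1
  have lag s = 0, 1 and 2. Padding with zeros brings them all into one sum of formal degree n +
  2.\<close>

lemma power_mult_rev_poly:
  fixes g :: "nat \<Rightarrow> complex"
  assumes "s \<le> r"
  shows "z ^ (r - s) * (\<Sum>i\<le>n. g i * z ^ (n - i))
    = (\<Sum>k\<le>n + r. (if s \<le> k \<and> k \<le> n + s then g (k - s) else 0) * z ^ (n + r - k))"
proof -
  have "(\<Sum>k\<le>n + r. (if s \<le> k \<and> k \<le> n + s then g (k - s) else 0) * z ^ (n + r - k))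
    = (\<Sum>k\<in>{s..n + s}. g (k - s) * z ^ (n + r - k))"
    using assms by (intro sum.mono_neutral_cong_right) auto
  also have "\<dots> = (\<Sum>i\<le>n. g i * z ^ ((r - s) + (n - i)))"
    using assms
    by (intro sum.reindex_bij_witness[of _ "\<lambda>i. i + s" "\<lambda>k. k - s"])
       (auto intro!: arg_cong[of _ _ "\<lambda>k. z ^ k"])
  also have "\<dots> = z ^ (r - s) * (\<Sum>i\<le>n. g i * z ^ (n - i))"
    by (simp only: power_add sum_distrib_left mult.left_commute)
  finally show ?thesis ..
qed

text \<open>These are the coefficients of the n + 1 highest powers of \<lambda>. The two below them,
  at k = n + 1 and k = n + 2, are conditions (A) and (B), differentiated.\<close>

lemma nls_soliton_res:
  assumes op: "open I" and sol: "nls_soliton I \<sigma> q n B" and x: "x \<in> I" and k: "k \<le> n"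
  shows "soliton_res (Efun q) (Ffun \<sigma> q) B k x = 0"
proof -
  let ?L = "\<lambda>g z. \<Sum>i\<le>n. g i * z ^ (n - i) :: complex"
  let ?E = "bracket (Efun q)" and ?F = "bracket (Ffun \<sigma> q)"
  have sm: "i \<in> {..n} \<Longrightarrow> smooth_on I (B i)" for i
    using sol by (simp add: nls_soliton_def)
  have lam: "lam_poly n B z y = (\<Sum>i\<le>n. z ^ (n - i) * B i y)" for z y
    by (simp add: lam_poly_def mult.commute)
  \<comment> \<open>Written in the exact shape that \<open>power_mult_rev_poly\<close> produces for
    s = 2, 0, 1, 2, including the trivial guards for s = 0.\<close>
  define c where "c = (\<lambda>k. (if 2 \<le> k \<and> k \<le> n + 2 then dx (dx (dx (B (k - 2)))) x else 0)
     + 4 * (if 0 \<le> k \<and> k \<le> n + 0 then dx (B (k - 0)) x else 0)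
     - 2 * ((if 1 \<le> k \<and> k \<le> n + 1 then ?E (B (k - 1)) x else 0)
     + (if 2 \<le> k \<and> k \<le> n + 2 then ?F (B (k - 2)) x else 0)))"
  have "(\<Sum>k\<le>n + 2. c k * z ^ (n + 2 - k)) = 0" for z
  proof -
    have 1: "dx (lam_poly n B z) x = ?L (\<lambda>i. dx (B i) x) z"
      using dx_lin[OF op x lam sm] by (simp add: mult.commute)
    have 2: "dx (dx (dx (lam_poly n B z))) x = ?L (\<lambda>i. dx (dx (dx (B i))) x) z"
      using dx3_lin[OF op x lam sm] by (simp add: mult.commute)
    have 3: "bracket E (lam_poly n B z) x = ?L (\<lambda>i. bracket E (B i) x) z" for E
      using bracket_lin[OF op x lam sm] by (simp add: mult.commute)
    have "0 = dx (dx (dx (lam_poly n B z))) x + 4 * z\<^sup>2 * dx (lam_poly n B z) x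
        - 2 * (z * ?E (lam_poly n B z) x + ?F (lam_poly n B z) x)"
      using sol x unfolding nls_soliton_def Let_def by metis
    also have "\<dots> = z ^ (2 - 2) * ?L (\<lambda>i. dx (dx (dx (B i))) x) z + 4 * (z ^ (2 - 0) * ?L (\<lambda>i. dx (B i) x) z)
        - 2 * (z ^ (2 - 1) * ?L (\<lambda>i. ?E (B i) x) z + z ^ (2 - 2) * ?L (\<lambda>i. ?F (B i) x) z)"
      unfolding 1 2 3 by simp
    also have "\<dots> = (\<Sum>k\<le>n + 2. c k * z ^ (n + 2 - k))"
      unfolding power_mult_rev_poly[OF order.refl] power_mult_rev_poly[OF zero_le]
        power_mult_rev_poly[OF one_le_numeral]
      unfolding c_def distrib_right left_diff_distrib sum.distrib sum_subtractf mult.assoc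
        sum_distrib_left[symmetric] ..
    finally show ?thesis by simp
  qed
  from rev_poly_eq_0[where N="n + 2" and c=c, OF this] have "c k = 0" using k by simp
  moreover consider "k = 0" | "k = Suc 0" | j where "k = Suc (Suc j)"
    by (metis not0_implies_Suc)
  then have "c k = soliton_res (Efun q) (Ffun \<sigma> q) B k x"
    using k by cases (simp_all add: c_def soliton_res_def bracket_def[of _ "\<lambda>_. 0"])
  ultimately show ?thesis by simp
qed

text \<open>The product of \<open>\<alpha> j\<close> and the i-th basic coefficient always stands at
  exponent n - (j + i), so collecting equal j + i gives a Cauchy product.\<close>

lemma sum_basic_poly:
  "(\<Sum>j\<le>n. \<alpha> j * basic_poly \<sigma> q (n - j) z x)
    = (\<Sum>i\<le>n. (\<Sum>j\<le>i. \<alpha> j * Afun \<sigma> q (i - j) x) * z ^ (n - i))"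
proof -
  let ?g = "\<lambda>j i. \<alpha> j * Afun \<sigma> q i x * z ^ (n - (j + i))"
  have "(\<Sum>j\<le>n. \<alpha> j * basic_poly \<sigma> q (n - j) z x) = (\<Sum>j\<le>n. \<Sum>i\<le>n - j. ?g j i)"
    by (simp add: basic_poly_def lam_poly_def sum_distrib_left mult.assoc)
  also have "\<dots> = (\<Sum>(j, i)\<in>Sigma {..n} (\<lambda>j. {..n - j}). ?g j i)"
    by (simp add: sum.Sigma)
  also have "Sigma {..n} (\<lambda>j. {..n - j}) = {(j, i). j + i \<le> n}"
    by auto
  also have "(\<Sum>(j, i)\<in>{(j, i). j + i \<le> n}. ?g j i) = (\<Sum>k\<le>n. \<Sum>j\<le>k. ?g j (k - j))"
    by (rule sum.triangle_reindex_eq)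
  also have "\<dots> = (\<Sum>i\<le>n. (\<Sum>j\<le>i. \<alpha> j * Afun \<sigma> q (i - j) x) * z ^ (n - i))"
    by (intro sum.cong) (auto simp: sum_distrib_right)
  finally show ?thesis .
qed

text \<open>Comparing powers of \<lambda> at each x reduces both claims to coefficients: one
  direction is the formula for \<open>B i\<close>, the other turns
  \<open>soliton_res_expansion\<close> into existence of \<alpha>.\<close>

lemma basic_expansion_iff:
  "basic_expansion I \<sigma> q n B \<alpha>
    \<longleftrightarrow> (\<forall>i\<le>n. \<forall>x\<in>I. B i x = (\<Sum>j\<le>i. \<alpha> j * Afun \<sigma> q (i - j) x))"
proof
  assume *: "basic_expansion I \<sigma> q n B \<alpha>"
  show "\<forall>i\<le>n. \<forall>x\<in>I. B i x = (\<Sum>j\<le>i. \<alpha> j * Afun \<sigma> q (i - j) x)"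
  proof (intro allI impI ballI)
    fix i x assume i: "i \<le> n" and x: "x \<in> I"
    have "(\<Sum>i\<le>n. (B i x - (\<Sum>j\<le>i. \<alpha> j * Afun \<sigma> q (i - j) x)) * z ^ (n - i)) = 0" for z
      using * x unfolding basic_expansion_def sum_basic_poly
      by (simp add: lam_poly_def left_diff_distrib sum_subtractf)
    from rev_poly_eq_0[OF this i] show "B i x = (\<Sum>j\<le>i. \<alpha> j * Afun \<sigma> q (i - j) x)"
      by simp
  qed
next
  assume "\<forall>i\<le>n. \<forall>x\<in>I. B i x = (\<Sum>j\<le>i. \<alpha> j * Afun \<sigma> q (i - j) x)"
  then show "basic_expansion I \<sigma> q n B \<alpha>"
    unfolding basic_expansion_def sum_basic_poly lam_poly_def
    by (intro allI ballI sum.cong) auto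
qed

section \<open>Indefinite integrals up to constants\<close>

lemma has_vector_derivative_indef:
  assumes "a < b" "I = einterval a b" "\<And>x. x \<in> I \<Longrightarrow> isCont f x" "x \<in> I"
  shows "(indef I f has_vector_derivative f x) (at x)"
proof -
  \<comment> \<open>Continuity provides an antiderivative on the whole interval, so the choice in
    \<open>indef\<close> is genuine.\<close>
  have "\<exists>G. \<forall>x\<in>I. (G has_vector_derivative f x) (at x)"
    using einterval_antiderivative[OF assms(1), of f] assms(3) unfolding assms(2) Ball_def einterval_iff
    by blast
  from someI_ex[OF this] show ?thesis
    using assms(4) unfolding indef_def by blast
qed

text \<open>The antiderivatives are chosen independently, so \<open>indef\<close> is linear only up
  to a constant: both sides have the same derivative on an interval.\<close>

lemma indef_lin:
  assumes I: "a < b" "I = einterval a b"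
    and cont: "\<And>x. x \<in> I \<Longrightarrow> isCont f x" "\<And>k x. k \<in> S \<Longrightarrow> x \<in> I \<Longrightarrow> isCont (g k) x"
    and eq: "\<And>x. x \<in> I \<Longrightarrow> f x = (\<Sum>k\<in>S. c k * g k x)"
  shows "eq_upto_const I (indef I f) (\<lambda>x. \<Sum>k\<in>S. c k * indef I (g k) x)"
proof -
  have "((\<lambda>x. indef I f x - (\<Sum>k\<in>S. c k * indef I (g k) x)) has_vector_derivative 0) (at x)"
    if "x \<in> I" for x
    using has_vector_derivative_diff[OF has_vector_derivative_indef[OF I cont(1) that]
        has_dx_lin[of S "\<lambda>k. indef I (g k)" "\<lambda>k. g k x" x c,
          OF has_vector_derivative_indef[OF I cont(2) that]]] eq[OF that]
    by simp
  then obtain d where "\<And>x. x \<in> I \<Longrightarrow> indef I f x - (\<Sum>k\<in>S. c k * indef I (g k) x) = d"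
    using constant_on_einterval[of a b "\<lambda>x. indef I f x - (\<Sum>k\<in>S. c k * indef I (g k) x)"] I(2)
    by blast
  then show ?thesis
    unfolding eq_upto_const_def by (metis diff_add_cancel add.commute)
qed

lemma isCont_bracket:
  assumes "smooth_on I f" "smooth_on I g" "x \<in> I"
  shows "isCont (bracket f g) x"
  unfolding bracket_def[abs_def]
  by (intro continuous_intros smooth_on_isCont[OF _ assms(3)] smooth_on_dx assms)

lemma eq_upto_const_sym: "eq_upto_const I f g \<Longrightarrow> eq_upto_const I g f"
  unfolding eq_upto_const_def by (metis add_diff_cancel_right' diff_conv_add_uminus)

lemma eq_upto_const_trans: "eq_upto_const I f g \<Longrightarrow> eq_upto_const I g h \<Longrightarrow> eq_upto_const I f h"
  unfolding eq_upto_const_def by (metis add.assoc)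

lemma eq_upto_const_diff_0:
  "eq_upto_const I f g \<longleftrightarrow> eq_upto_const I (\<lambda>x. f x - g x) (\<lambda>_. 0)"
  unfolding eq_upto_const_def by (metis add_0 add.commute diff_eq_eq)

lemma eq_upto_const_sub_indef:
  assumes "\<And>x. x \<in> I \<Longrightarrow> u x = (\<Sum>k\<in>S. c k * v k x)"
    and "eq_upto_const I f (\<lambda>x. \<Sum>k\<in>S. c k * g k x)"
  shows "eq_upto_const I (\<lambda>x. u x - 2 * f x) (\<lambda>x. \<Sum>k\<in>S. c k * (v k x - 2 * g k x))"
proof -
  obtain d where "\<And>x. x \<in> I \<Longrightarrow> f x = (\<Sum>k\<in>S. c k * g k x) + d"
    using assms(2) unfolding eq_upto_const_def by blast
  then have "\<forall>x\<in>I. u x - 2 * f x = (\<Sum>k\<in>S. c k * (v k x - 2 * g k x)) + (- 2 * d)"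
    using assms(1) by (simp add: right_diff_distrib sum_subtractf sum_distrib_left mult.left_commute distrib_left)
  then show ?thesis
    unfolding eq_upto_const_def by blast
qed

text \<open>The second derivatives agree exactly by linearity; the additive constant comes from the
  integrals alone.\<close>

lemma diff_B_conv:
  assumes I: "a < b" "I = einterval a b" and smF: "smooth_on I (Ffun \<sigma> q)"
    and smA: "\<And>i. smooth_on I (A i)" and smB: "smooth_on I (B n)"
    and B: "\<And>x. x \<in> I \<Longrightarrow> B n x = (\<Sum>j\<le>n. \<alpha> j * A (n - j) x)"
  shows "eq_upto_const I (diff_B I \<sigma> q B n) (\<lambda>x. \<Sum>k\<le>n. \<alpha> k * diff_B I \<sigma> q A (n - k) x)"
proof -
  have op: "open I" using I by simp
  show ?thesis
    unfolding diff_B_def[abs_def]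
    by (intro eq_upto_const_sub_indef indef_lin[OF I] isCont_bracket[of I]
          dx2_lin[OF op] bracket_lin[OF op])
       (use smF smA smB B in auto)
qed

lemma diff_A_conv:
  assumes I: "a < b" "I = einterval a b" and smE: "smooth_on I (Efun q)"
    and smF: "smooth_on I (Ffun \<sigma> q)"
    and smA: "\<And>i. smooth_on I (A i)" and smB: "\<forall>i\<le>n. smooth_on I (B i)"
    and B: "\<And>i x. i \<le> n \<Longrightarrow> x \<in> I \<Longrightarrow> B i x = (\<Sum>j\<le>i. \<alpha> j * A (i - j) x)"
  shows "eq_upto_const I (diff_A I \<sigma> q B n) (\<lambda>x. \<Sum>k\<le>n. \<alpha> k * diff_A I \<sigma> q A (n - k) x)"
proof -
  have op: "open I" using I by simp
  have smpA: "smooth_on I (prev A i)" for i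
    using smooth_on_prev[OF op, of i A i] smA by simp
  have smpB: "smooth_on I (prev B n)"
    using smooth_on_prev[OF op smB] by simp
  have p: "prev B n x = (\<Sum>j\<le>n. \<alpha> j * prev A (n - j) x)" if "x \<in> I" for x
    using B that by (intro prev_conv[of n B]) auto
  have 1: "dx (dx (prev B n)) x = (\<Sum>j\<le>n. \<alpha> j * dx (dx (prev A (n - j))) x)" if "x \<in> I" for x
    using dx2_lin[OF op that p smpA] .
  have 2: "bracket (Efun q) (B n) x + bracket (Ffun \<sigma> q) (prev B n) x
      = (\<Sum>j\<le>n. \<alpha> j * (bracket (Efun q) (A (n - j)) x + bracket (Ffun \<sigma> q) (prev A (n - j)) x))"
    if "x \<in> I" for x
    using bracket_lin[OF op that B[OF order.refl] smA] bracket_lin[OF op that p smpA]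
    by (simp add: distrib_left sum.distrib)
  show ?thesis
    unfolding diff_A_def[abs_def]
    by (rule eq_upto_const_sub_indef[OF 1 indef_lin[OF I _ _ 2]])
       (use smE smF smA smB smpA smpB in \<open>auto intro!: continuous_add isCont_bracket\<close>)
qed

theorem theorem13p1:
  fixes a b :: ereal and I :: "real set" and \<sigma> :: real and q :: "real \<Rightarrow> complex"
    and n :: nat and B :: "nat \<Rightarrow> real \<Rightarrow> complex"
  assumes interval: "a < b" "I = einterval a b"
    and sigma: "\<sigma> = 1 \<or> \<sigma> = -1"
    and q_smooth: "smooth_on I q"
    and q_nonzero: "\<forall>x\<in>I. q x \<noteq> 0"
    and soliton: "nls_soliton I \<sigma> q n B"
  shows "(\<exists>\<alpha>. basic_expansion I \<sigma> q n B \<alpha>) \<and>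
    (\<forall>\<alpha>. basic_expansion I \<sigma> q n B \<alpha> \<longrightarrow>
       (\<forall>i\<le>n. \<forall>x\<in>I. B i x = (\<Sum>j\<le>i. \<alpha> j * Afun \<sigma> q (i - j) x)) \<and>
       eq_upto_const I (diff_A I \<sigma> q B n) (\<lambda>x. \<Sum>k\<le>n. \<alpha> k * calA I \<sigma> q (n - k) x) \<and>
       eq_upto_const I (diff_B I \<sigma> q B n) (\<lambda>x. \<Sum>k\<le>n. \<alpha> k * calB I \<sigma> q (n - k) x) \<and>
       (cond_A I \<sigma> q n B \<longleftrightarrow>
          eq_upto_const I (\<lambda>x. \<Sum>k\<le>n. \<alpha> k * calA I \<sigma> q (n - k) x) (\<lambda>_. 0)) \<and>
       (cond_B I \<sigma> q n B \<longleftrightarrow>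
          eq_upto_const I (\<lambda>x. \<Sum>k\<le>n. \<alpha> k * calB I \<sigma> q (n - k) x) (\<lambda>_. 0)))"
proof -
  have op: "open I" using interval by simp
  note smE = smooth_on_Efun[OF op q_smooth q_nonzero]
  note smF = smooth_on_Ffun[OF op q_smooth q_nonzero]
  have smA: "smooth_on I (Afun \<sigma> q i)" for i
    unfolding Afun_def by (rule smooth_on_dp_eval[OF op smE smF])
  have smB: "\<forall>i\<le>n. smooth_on I (B i)"
    using soliton by (simp add: nls_soliton_def)
  have "\<exists>\<alpha>. \<forall>i<Suc n. \<forall>x\<in>I. B i x = (\<Sum>j\<le>i. \<alpha> j * Afun \<sigma> q (i - j) x)"
  proof (rule soliton_res_expansion[OF interval(2) smA])
    show "Afun \<sigma> q 0 x = 2" for x by (simp add: Afun_def)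
    show "soliton_res (Efun q) (Ffun \<sigma> q) (Afun \<sigma> q) i x = 0" if "x \<in> I" for i x
      by (rule soliton_res_Afun[OF op q_smooth q_nonzero that])
    show "smooth_on I (B i)" if "i < Suc n" for i
      using smB that by simp
    show "soliton_res (Efun q) (Ffun \<sigma> q) B i x = 0" if "i < Suc n" "x \<in> I" for i x
      using nls_soliton_res[OF op soliton that(2)] that(1) by simp
  qed
  then have ex: "\<exists>\<alpha>. basic_expansion I \<sigma> q n B \<alpha>"
    by (simp add: basic_expansion_iff less_Suc_eq_le)
  \<comment> \<open>Both conditions say that the difference of their sides is constant, so equality
    up to constants, being symmetric and transitive, carries them over to the sums.\<close>
  have A: "cond_A I \<sigma> q n B \<longleftrightarrow> eq_upto_const I (diff_A I \<sigma> q B n) (\<lambda>_. 0)"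
    unfolding cond_A_def by (subst eq_upto_const_diff_0) (simp add: diff_A_def[abs_def])
  have B: "cond_B I \<sigma> q n B \<longleftrightarrow> eq_upto_const I (diff_B I \<sigma> q B n) (\<lambda>_. 0)"
    unfolding cond_B_def by (subst eq_upto_const_diff_0) (simp add: diff_B_def[abs_def])
  show ?thesis
  proof (intro conjI allI impI ballI ex)
    fix \<alpha> assume "basic_expansion I \<sigma> q n B \<alpha>"
    then have *: "\<forall>i\<le>n. \<forall>x\<in>I. B i x = (\<Sum>j\<le>i. \<alpha> j * Afun \<sigma> q (i - j) x)"
      by (simp add: basic_expansion_iff)
    then show "B i x = (\<Sum>j\<le>i. \<alpha> j * Afun \<sigma> q (i - j) x)" if "i \<le> n" "x \<in> I" for i x
      using that by blast
    show eqA: "eq_upto_const I (diff_A I \<sigma> q B n) (\<lambda>x. \<Sum>k\<le>n. \<alpha> k * calA I \<sigma> q (n - k) x)"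
      using * by (intro diff_A_conv[OF interval smE smF smA smB]) blast
    show eqB: "eq_upto_const I (diff_B I \<sigma> q B n) (\<lambda>x. \<Sum>k\<le>n. \<alpha> k * calB I \<sigma> q (n - k) x)"
      using * smB by (intro diff_B_conv[OF interval smF smA]) auto
    show "cond_A I \<sigma> q n B \<longleftrightarrow>
        eq_upto_const I (\<lambda>x. \<Sum>k\<le>n. \<alpha> k * calA I \<sigma> q (n - k) x) (\<lambda>_. 0)"
      unfolding A using eqA eq_upto_const_sym eq_upto_const_trans by blast
    show "cond_B I \<sigma> q n B \<longleftrightarrow>
        eq_upto_const I (\<lambda>x. \<Sum>k\<le>n. \<alpha> k * calB I \<sigma> q (n - k) x) (\<lambda>_. 0)"
      unfolding B using eqB eq_upto_const_sym eq_upto_const_trans by blast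
  qed
qed

end
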